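(* For all integers $\ell\ge 1$, $m\ge 2$ and $1\le k\le m-1$, $$c_{m,k+1}(\ell+1)=c_{m,k+1}(\ell)+c_{m,k}(\ell).$$
   Context: A composition of a positive integer $\ell$ is a finite ordered sequence of positive integers (called parts) whose sum is $\ell$; positions of parts are numbered $1,2,3,\dots$ from left to right. For integers $m\ge 1$ and $k$, a $(m,k)$-$n$-colored composition of $\ell$ is a composition of $\ell$ in which each part whose position is congruent to $k$ modulo $m$ is $n$-colored, i.e. if it has size $p$ it is given one of $p$ colors $1,\dots,p$, while all other parts are not colored. $c_{m,k}(\ell)$ denotes the number of $(m,k)$-$n$-colored compositions of $\ell$ (so $c_{m,k}$ depends only on $k$ modulo $m$). *)

theory Defs
  imports Main "HOL-Number_Theory.Cong"
begin

definition compositions :: "nat \<Rightarrow> nat list set" where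
  "compositions l = {ps. (\<forall>p\<in>set ps. p \<ge> 1) \<and> sum_list ps = l}"

(* A coloured composition is a list of pairs (size, colour). The colour is Some c with
   1 <= c <= size for an n-coloured part, and None for a part that is not coloured.
   Positions are numbered from 1, so the list entry with index i has position Suc i. *)
definition n_colored_compositions :: "nat \<Rightarrow> int \<Rightarrow> nat \<Rightarrow> (nat \<times> nat option) list set" where
  "n_colored_compositions m k l =
     {xs. map fst xs \<in> compositions l \<and>
          (\<forall>i<length xs.
             if [int (Suc i) = k] (mod int m)
             then \<exists>c\<in>{1..fst (xs ! i)}. snd (xs ! i) = Some c
             else snd (xs ! i) = None)}"

definition num_n_colored_compositions :: "nat \<Rightarrow> int \<Rightarrow> nat \<Rightarrow> nat" where
  "num_n_colored_compositions m k l = card (n_colored_compositions m k l)"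

(* The set counted above is finite, so its cardinality is a genuine count. *)
lemma finite_n_colored_compositions: "finite (n_colored_compositions m k l)"
proof (rule finite_subset)
  let ?A = "{..l} \<times> insert None (Some ` {..l})"
  show "finite {xs. set xs \<subseteq> ?A \<and> length xs \<le> l}"
    by (rule finite_lists_length_le) auto
  show "n_colored_compositions m k l \<subseteq> {xs. set xs \<subseteq> ?A \<and> length xs \<le> l}"
  proof
    fix xs assume xs: "xs \<in> n_colored_compositions m k l"
    have pos: "\<forall>p\<in>set (map fst xs). 1 \<le> p" and s: "sum_list (map fst xs) = l"
      using xs unfolding n_colored_compositions_def compositions_def by blast+
    have "length ps \<le> sum_list ps" if "\<forall>p\<in>set ps. 1 \<le> p" for ps :: "nat list"
      using that by (induction ps) auto
    from this[OF pos] s have len: "length xs \<le> l" by simp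
    have "x \<in> ?A" if x: "x \<in> set xs" for x
    proof -
      obtain i where i: "i < length xs" "x = xs ! i"
        using x by (metis in_set_conv_nth)
      have "fst x \<in> set (map fst xs)" using x by simp
      then have le: "fst x \<le> l"
        unfolding s[symmetric] by (rule member_le_sum_list) simp_all
      have "snd x = None \<or> (\<exists>c\<in>{1..fst x}. snd x = Some c)"
        using xs i unfolding n_colored_compositions_def by (smt (verit) mem_Collect_eq)
      then have "snd x \<in> insert None (Some ` {..l})"
        using le by force
      with le show ?thesis by (simp add: mem_Times_iff)
    qed
    with len show "xs \<in> {xs. set xs \<subseteq> ?A \<and> length xs \<le> l}" by blast
  qed
qed

end

theory Submission
  imports Defs
begin

text \<open>
  When \<open>k\<close> is not divisible by \<open>m\<close>, position 1 is not colored in an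
  \<open>(m, k + 1)\<close>-colored composition of \<open>l + 1\<close>. If the first part is 1, removing it
  shifts all positions by one and leaves an \<open>(m, k)\<close>-colored composition of \<open>l\<close>;
  otherwise, decreasing it by 1 leaves an \<open>(m, k + 1)\<close>-colored composition of \<open>l\<close>.
\<close>

text \<open>Deleting the first part lowers every later position by one, which moves the colored
  residue class from \<open>k\<close> to \<open>k - 1\<close>; as \<open>k\<close> is an integer,
  this needs no case split at 0.\<close>

lemma Cons_in_n_colored_compositions_iff:
  "(p, c) # xs \<in> n_colored_compositions m k l \<longleftrightarrow>
     1 \<le> p \<and> p \<le> l \<and>
     (if [1 = k] (mod int m) then c \<in> Some ` {1..p} else c = None) \<and>
     xs \<in> n_colored_compositions m (k - 1) (l - p)"
proof -
  have shift: "[int (Suc (Suc i)) = k] (mod int m) \<longleftrightarrow> [int (Suc i) = k - 1] (mod int m)" for i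
    by (simp add: cong_iff_dvd_diff algebra_simps)
  \<comment> \<open>Subtraction on \<open>nat\<close> truncates, so the bound
    \<open>p \<le> l\<close> has to be carried along.\<close>
  have sum: "p + s = l \<longleftrightarrow> p \<le> l \<and> s = l - p" for s :: nat
    by auto
  show ?thesis
    unfolding n_colored_compositions_def compositions_def
    by (simp only: mem_Collect_eq length_Cons All_less_Suc2 nth_Cons_0 nth_Cons_Suc shift)
      (auto simp: sum)
qed

lemma uncolored_first_part_step:
  assumes "l \<ge> 1" and first: "\<not> [1 = k] (mod int m)"
  shows "num_n_colored_compositions m k (l + 1) =
           num_n_colored_compositions m k l + num_n_colored_compositions m (k - 1) l"
proof -
  let ?N = "n_colored_compositions m"
  \<comment> \<open>The value of \<open>?inc\<close> at \<open>[]\<close> is irrelevant: since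
    \<open>l \<ge> 1\<close>, the fact \<open>Nil\<close> excludes the empty list.\<close>
  let ?inc = "\<lambda>xs :: (nat \<times> nat option) list. (Suc (fst (hd xs)), None) # tl xs"
  let ?one = "Cons (1 :: nat, None :: nat option)"
  have Nil: "[] \<notin> ?N k l" "[] \<notin> ?N k (l + 1)"
    using assms(1) by (auto simp: n_colored_compositions_def compositions_def)
  have Cons: "(p, c) # xs \<in> ?N k n \<longleftrightarrow>
      1 \<le> p \<and> p \<le> n \<and> c = None \<and> xs \<in> ?N (k - 1) (n - p)" for p c xs n
    using first by (simp add: Cons_in_n_colored_compositions_iff)
  have "?N k (l + 1) = ?inc ` ?N k l \<union> ?one ` ?N (k - 1) l"
  proof (intro equalityI subsetI)
    fix xs assume xs: "xs \<in> ?N k (l + 1)"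
    then obtain p c ys where eq: "xs = (p, c) # ys"
      using Nil by (metis list.exhaust surj_pair)
    with xs have p: "1 \<le> p" "p \<le> l + 1" and c: "c = None" and ys: "ys \<in> ?N (k - 1) (l + 1 - p)"
      by (simp_all add: Cons)
    show "xs \<in> ?inc ` ?N k l \<union> ?one ` ?N (k - 1) l"
    proof (cases "p = 1")
      case True
      with eq c ys show ?thesis by simp
    next
      case False
      \<comment> \<open>Here \<open>p \<ge> 2\<close>, so \<open>p - 1\<close> is still a valid
        part, and \<open>l - (p - 1) = l + 1 - p\<close>.\<close>
      with p ys have "(p - 1, None) # ys \<in> ?N k l" by (auto simp: Cons)
      moreover have "xs = ?inc ((p - 1, None) # ys)" using eq c p by simp
      ultimately show ?thesis by blast
    qed
  next
    fix xs assume "xs \<in> ?inc ` ?N k l \<union> ?one ` ?N (k - 1) l"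
    then show "xs \<in> ?N k (l + 1)"
    proof
      assume "xs \<in> ?inc ` ?N k l"
      then obtain ys where ys: "ys \<in> ?N k l" "xs = ?inc ys" by blast
      then obtain p c zs where "ys = (p, c) # zs"
        using Nil by (metis list.exhaust surj_pair)
      with ys show ?thesis by (simp add: Cons)
    qed (auto simp: Cons)
  qed
  \<comment> \<open>First parts are at least 2 in the image of \<open>?inc\<close> and equal to 1 in
    that of \<open>?one\<close>.\<close>
  moreover have "?inc ` ?N k l \<inter> ?one ` ?N (k - 1) l = {}"
  proof -
    have "fst (hd ys) \<ge> 1" if "ys \<in> ?N k l" for ys
      using that Nil by (cases ys) (auto simp: Cons)
    then show ?thesis by fastforce
  qed
  \<comment> \<open>\<open>?inc\<close> overwrites the first color, but on \<open>?N k l\<close>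
    that color is always \<open>None\<close>, so nothing is lost.\<close>
  moreover have "inj_on ?inc (?N k l)"
  proof (rule inj_onI)
    fix xs ys assume *: "xs \<in> ?N k l" "ys \<in> ?N k l" "?inc xs = ?inc ys"
    obtain p c xs' where "xs = (p, c) # xs'" using *(1) Nil by (metis list.exhaust surj_pair)
    moreover obtain q d ys' where "ys = (q, d) # ys'"
      using *(2) Nil by (metis list.exhaust surj_pair)
    ultimately show "xs = ys" using * by (simp add: Cons)
  qed
  moreover have "inj_on ?one (?N (k - 1) l)" by simp
  ultimately show ?thesis
    unfolding num_n_colored_compositions_def
    by (simp add: card_Un_disjoint card_image finite_n_colored_compositions)
qed

theorem theorem3p6:
  fixes l m :: nat and k :: int
  assumes "l \<ge> 1" and "m \<ge> 2" and "1 \<le> k" and "k \<le> int m - 1"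
  shows "num_n_colored_compositions m (k + 1) (l + 1) =
           num_n_colored_compositions m (k + 1) l + num_n_colored_compositions m k l"
proof -
  \<comment> \<open>Position 1 is colored for \<open>k + 1\<close> exactly when \<open>m\<close>
    divides \<open>k\<close>, which \<open>0 < k < m\<close> rules out.\<close>
  have "\<not> int m dvd k"
    using assms zdvd_not_zless[of k "int m"] by simp
  then have "\<not> [1 = k + 1] (mod int m)"
    by (simp add: cong_iff_dvd_diff)
  from uncolored_first_part_step[OF assms(1) this] show ?thesis by simp
qed

end
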